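(* Let $X\in\mathfrak{sl}_n(\mathbb{R})$ be a nilpotent element corresponding to the partition $\mathbf{d}\in\mathcal{P}(n)$. Then the following statements are equivalent: (1) $X$ is real (with respect to $\mathrm{SL}_n(\mathbb{R})$). (2) $X$ is strongly real (with respect to $\mathrm{SL}_n(\mathbb{R})$). (3) $\mathbf{d}\notin\widetilde{\mathcal{P}_e}(n)$.
   Context: For a Lie group $G$ with Lie algebra $\mathfrak{g}$, $X\in\mathfrak{g}$ is real ($\mathrm{Ad}_G$-real) if $-X=\mathrm{Ad}(g)X$ for some $g\in G$, and strongly real (strongly $\mathrm{Ad}_G$-real) if $-X=\mathrm{Ad}(\tau)X$ for some $\tau\in G$ with $\tau^2=\mathrm{Id}$. Here $G=\mathrm{SL}_n(\mathbb{R})$. $\mathcal{P}(n)$ is the set of partitions of $n$, written $\mathbf{d}=[d_1^{t_{d_1}},\dots,d_s^{t_{d_s}}]$ with $d_1>\dots>d_s>0$, $t_{d_i}\ge 1$, $\sum_i t_{d_i}d_i=n$. The partition corresponding to a nilpotent $X$ is given by its Jordan block sizes ($t_d$ is the number of Jordan blocks of size $d$). Put $\mathbb{N}_{\mathbf d}=\{d_1,\dots,d_s\}$, $\mathbb{E}_{\mathbf d}$ the set of even elements of $\mathbb{N}_{\mathbf d}$, and $\mathbb{E}^2_{\mathbf d}=\{\eta\in\mathbb{E}_{\mathbf d}\mid \eta\equiv 2 \pmod 4\}$. $\mathcal{P}_{\mathrm{even}}(n)$ is the set of $\mathbf d\in\mathcal P(n)$ with $\mathbb{N}_{\mathbf d}=\mathbb{E}_{\mathbf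 d}$ (all parts even); $\mathcal{P}_{\mathrm{v.even}}(n)$ is the subset of those $\mathbf d\in \mathcal{P}_{\mathrm{even}}(n)$ for which $t_\eta$ is even for all $\eta\in\mathbb{N}_{\mathbf d}$. Finally $$\widetilde{\mathcal{P}_e}(n)=\Big\{\mathbf d\in\mathcal{P}_{\mathrm{even}}(n)\setminus\mathcal{P}_{\mathrm{v.even}}(n)\;\Big|\;\sum_{\eta\in\mathbb{E}^2_{\mathbf d}}t_\eta\ \text{is odd}\Big\}.$$ *)

theory Defs
  imports
    "Jordan_Normal_Form.Jordan_Normal_Form"
    "HOL-Library.Multiset"
    "HOL-Algebra.Group"
begin

definition SL_group :: "nat \<Rightarrow> real mat monoid" where
  "SL_group n =
    \<lparr>carrier = {g \<in> carrier_mat n n. det g = 1}, monoid.mult = (*), one = 1\<^sub>m n\<rparr>"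

definition sl_algebra :: "nat \<Rightarrow> real mat set" where
  "sl_algebra n = {X \<in> carrier_mat n n. (\<Sum>i<n. X $$ (i, i)) = 0}"

text \<open>The adjoint action of a linear Lie group on its Lie algebra is conjugation of matrices.\<close>

definition Ad :: "real mat monoid \<Rightarrow> real mat \<Rightarrow> real mat \<Rightarrow> real mat" where
  "Ad G g X = g * X * inv\<^bsub>G\<^esub> g"

definition Ad_real :: "real mat monoid \<Rightarrow> real mat \<Rightarrow> bool" where
  "Ad_real G X \<longleftrightarrow> (\<exists>g \<in> carrier G. - X = Ad G g X)"

definition strongly_Ad_real :: "real mat monoid \<Rightarrow> real mat \<Rightarrow> bool" where
  "strongly_Ad_real G X \<longleftrightarrow>
    (\<exists>\<tau> \<in> carrier G. \<tau> \<otimes>\<^bsub>G\<^esub> \<tau> = \<one>\<^bsub>G\<^esub> \<and> - X = Ad G \<tau> X)"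

definition nilpotent_mat :: "nat \<Rightarrow> real mat \<Rightarrow> bool" where
  "nilpotent_mat n X \<longleftrightarrow> X \<in> carrier_mat n n \<and> (\<exists>k. X ^\<^sub>m k = 0\<^sub>m n n)"

text \<open>A partition is the multiset of its parts: the multiplicity $t_\eta$ is
  \<open>count d \<eta>\<close> and the set $\mathbb{N}_{\mathbf d}$ is \<open>set_mset d\<close>.\<close>

definition partitions :: "nat \<Rightarrow> nat multiset set" where
  "partitions n = {d. 0 \<notin># d \<and> sum_mset d = n}"

text \<open>All eigenvalues of a nilpotent matrix are zero, so its Jordan form is given by
  the block sizes alone.\<close>

definition corresponds_to_partition :: "real mat \<Rightarrow> nat multiset \<Rightarrow> bool" where
  "corresponds_to_partition X d \<longleftrightarrow>
    (\<exists>ds. mset ds = d \<and> jordan_nf X (map (\<lambda>k. (k, 0)) ds))"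

definition even_parts :: "nat multiset \<Rightarrow> nat set" where
  "even_parts d = {\<eta> \<in> set_mset d. even \<eta>}"

definition even_parts_2mod4 :: "nat multiset \<Rightarrow> nat set" where
  "even_parts_2mod4 d = {\<eta> \<in> even_parts d. \<eta> mod 4 = 2}"

definition even_partitions :: "nat \<Rightarrow> nat multiset set" where
  "even_partitions n = {d \<in> partitions n. set_mset d = even_parts d}"

definition very_even_partitions :: "nat \<Rightarrow> nat multiset set" where
  "very_even_partitions n =
    {d \<in> even_partitions n. \<forall>\<eta> \<in> set_mset d. even (count d \<eta>)}"

definition tilde_even_partitions :: "nat \<Rightarrow> nat multiset set" where
  "tilde_even_partitions n =
    {d \<in> even_partitions n - very_even_partitions n.
      odd (\<Sum>\<eta> \<in> even_parts_2mod4 d. count d \<eta>)}"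

end

theory Submission
  imports Defs
begin

text \<open>Pass to the Jordan form $J$. A diagonal matrix whose signs alternate along each Jordan
  block is an involution anticommuting with $J$. Flipping the signs of an odd block changes its
  determinant, so determinant 1 can be reached if there is an odd part; if all parts are even, the
  determinant is $(-1)^{n/2}$, and $n/2$ is congruent mod 2 to the sum of $t_\eta$ over the parts
  $\eta \equiv 2$ mod 4.

  Conversely let all parts be even and let $g$ anticommute with $J$. Its product $h$ with the
  diagonal sign matrix commutes with $J$. Call the position of a basis vector in its block its
  level; $h$ is block triangular with respect to levels, and commutation with $J$ makes the diagonal
  blocks of levels $2c$ and $2c+1$ equal. Hence $\det h$ is a square, which fixes the sign of
  $\det g$.\<close>

section \<open>Determinants of block triangular, permuted and decoupled matrices\<close>

text \<open>In the Leibniz expansion a permutation \<open>p\<close> survives only if the weight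
  never drops from \<open>i\<close> to \<open>p i\<close>. The weights \<open>w (p i)\<close> and
  \<open>w i\<close> have the same total, so a surviving \<open>p\<close> preserves the weight
  pointwise and meets only the diagonal blocks.\<close>

lemma det_weight_triangular:
  fixes A :: "'a :: comm_ring_1 mat" and w :: "nat \<Rightarrow> nat"
  assumes A: "A \<in> carrier_mat n n"
    and tri: "\<And>i j. i < n \<Longrightarrow> j < n \<Longrightarrow> w j < w i \<Longrightarrow> A $$ (i, j) = 0"
  shows "det A = det (mat n n (\<lambda>(i, j). if w i = w j then A $$ (i, j) else 0))"
proof -
  let ?B = "mat n n (\<lambda>(i, j). if w i = w j then A $$ (i, j) else 0)"
  have "(\<Prod>i = 0..<n. A $$ (i, p i)) = (\<Prod>i = 0..<n. ?B $$ (i, p i))"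
    if p: "p permutes {0..<n}" for p
  proof -
    have pn: "p i < n" if "i < n" for i
      using permutes_in_image[OF p, of i] that by auto
    show ?thesis
    proof (cases "\<exists>i<n. w (p i) < w i")
      case True
      then obtain i where i: "i < n" "w (p i) < w i" by blast
      then have "A $$ (i, p i) = 0" "?B $$ (i, p i) = 0" using tri pn by auto
      then have "(\<Prod>i = 0..<n. A $$ (i, p i)) = 0" "(\<Prod>i = 0..<n. ?B $$ (i, p i)) = 0"
        using i by (auto intro!: prod_zero)
      then show ?thesis by metis
    next
      case False
      then have le: "w i \<le> w (p i)" if "i \<in> {0..<n}" for i using that by force
      have "(\<Sum>i\<in>{0..<n}. w (p i)) = (\<Sum>i\<in>{0..<n}. w i)"
        using sum.permute[OF p, of w] by (simp add: comp_def)
      then have "w i = w (p i)" if "i < n" for i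
        using sum_mono_inv[of w "{0..<n}" "\<lambda>i. w (p i)" i] le that by auto
      then show ?thesis using pn by (intro prod.cong) auto
    qed
  qed
  then show ?thesis
    unfolding det_def'[OF A] det_def'[OF mat_carrier] by (intro sum.cong) auto
qed

text \<open>The sign of \<open>p\<close> enters once for the rows and once, via transposition, for
  the columns; its square is 1.\<close>

lemma det_permute_rows_cols:
  fixes A :: "'a :: comm_ring_1 mat"
  assumes A: "A \<in> carrier_mat n n" and p: "p permutes {0..<n}"
  shows "det (mat n n (\<lambda>(i, j). A $$ (p i, p j))) = det A"
proof -
  have pn: "p i < n" if "i < n" for i
    using permutes_in_image[OF p, of i] that by auto
  let ?B = "mat n n (\<lambda>(i, j). A $$ (p i, j))"
  let ?C = "mat n n (\<lambda>(i, j). transpose_mat ?B $$ (p i, j))"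
  have "mat n n (\<lambda>(i, j). A $$ (p i, p j)) = transpose_mat ?C"
    using pn by (intro eq_matI) auto
  then have "det (mat n n (\<lambda>(i, j). A $$ (p i, p j))) = det ?C"
    using det_transpose[of ?C n] by simp
  also have "\<dots> = signof p * det (transpose_mat ?B)"
    by (rule det_permute_rows[OF _ p]) auto
  also have "det (transpose_mat ?B) = det ?B"
    by (rule det_transpose) auto
  also have "\<dots> = signof p * det A"
    by (rule det_permute_rows[OF A p])
  finally show ?thesis by (simp add: sign_def)
qed

text \<open>Even and odd indices do not interact, so the matrix is a product of two factors, each
  the identity on the rows of the other parity.\<close>

lemma det_split_even_odd:
  fixes A :: "'a :: comm_ring_1 mat"
  assumes A: "A \<in> carrier_mat n n"
    and par: "\<And>i j. i < n \<Longrightarrow> j < n \<Longrightarrow> even i \<noteq> even j \<Longrightarrow> A $$ (i, j) = 0"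
  shows "det A = det (mat n n (\<lambda>(i, j). if even i then A $$ (i, j) else if i = j then 1 else 0))
    * det (mat n n (\<lambda>(i, j). if odd i then A $$ (i, j) else if i = j then 1 else 0))"
    (is "_ = det ?E * det ?O")
proof -
  have eq: "A = ?E * ?O"
  proof (rule eq_matI)
    fix i j assume "i < dim_row (?E * ?O)" "j < dim_col (?E * ?O)"
    then have i: "i < n" and j: "j < n" by auto
    have "(?E * ?O) $$ (i, j) = (\<Sum>k = 0..<n. ?E $$ (i, k) * ?O $$ (k, j))"
      using i j by (auto simp: scalar_prod_def)
    \<comment> \<open>Only one summand can survive: for even \<open>i\<close> the second factor has
      identity rows at the even \<open>k\<close>, for odd \<open>i\<close> the first factor has an
      identity row at \<open>i\<close>.\<close>
    also have "\<dots> = (\<Sum>k = 0..<n. if k = (if even i then j else i) then A $$ (i, j) else 0)"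
      using i j par by (intro sum.cong) auto
    also have "\<dots> = A $$ (i, j)" using i j by (simp add: sum.delta)
    finally show "A $$ (i, j) = (?E * ?O) $$ (i, j)" by simp
  qed (use A in auto)
  have "det A = det (?E * ?O)" by (rule arg_cong[OF eq])
  also have "\<dots> = det ?E * det ?O" by (rule det_mult) auto
  finally show ?thesis .
qed

section \<open>Matrices commuting with a nilpotent Jordan matrix\<close>

text \<open>This is the nilpotent Jordan matrix whose blocks begin at the indices of level 0. Levels
  give its entries directly, without recursion over the blocks.\<close>

definition chain_mat :: "nat \<Rightarrow> (nat \<Rightarrow> nat) \<Rightarrow> real mat" where
  "chain_mat n lev = mat n n (\<lambda>(i, j). if j = Suc i \<and> 0 < lev j then 1 else 0)"

lemma chain_mat_carrier [simp]: "chain_mat n lev \<in> carrier_mat n n"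
  by (simp add: chain_mat_def)

text \<open>The value of \<open>lev\<close> at an index is its zero-based position in its Jordan block.\<close>

definition is_level :: "(nat \<Rightarrow> nat) \<Rightarrow> bool" where
  "is_level lev \<longleftrightarrow> (\<forall>j. 0 < lev j \<longrightarrow> 0 < j \<and> lev j = Suc (lev (j - 1)))"

lemma is_levelD:
  assumes "is_level lev" "0 < lev j"
  obtains i where "j = Suc i" "lev j = Suc (lev i)"
  using assms unfolding is_level_def by (metis Suc_pred diff_Suc_1)

lemma mult_chain_mat:
  assumes "A \<in> carrier_mat n n" "i < n" "j < n" "is_level lev"
  shows "(A * chain_mat n lev) $$ (i, j) = (if 0 < lev j then A $$ (i, j - 1) else 0)"
proof -
  have "(A * chain_mat n lev) $$ (i, j) = (\<Sum>k = 0..<n. A $$ (i, k) * chain_mat n lev $$ (k, j))"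
    using assms by (auto simp: scalar_prod_def chain_mat_def)
  \<comment> \<open>Truncated subtraction is harmless: \<open>is_level\<close> forces level 0 at
    \<open>j = 0\<close>, and the term vanishes there.\<close>
  also have "\<dots> = (\<Sum>k = 0..<n. if k = j - 1 then (if 0 < lev j then A $$ (i, j - 1) else 0) else 0)"
    using assms by (intro sum.cong) (auto simp: chain_mat_def is_level_def)
  also have "\<dots> = (if 0 < lev j then A $$ (i, j - 1) else 0)"
    using assms by (simp add: sum.delta)
  finally show ?thesis .
qed

lemma chain_mat_mult:
  assumes "A \<in> carrier_mat n n" "i < n" "j < n"
  shows "(chain_mat n lev * A) $$ (i, j) =
    (if Suc i < n \<and> 0 < lev (Suc i) then A $$ (Suc i, j) else 0)"
proof -
  have "(chain_mat n lev * A) $$ (i, j) = (\<Sum>k = 0..<n. chain_mat n lev $$ (i, k) * A $$ (k, j))"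
    using assms by (auto simp: scalar_prod_def chain_mat_def)
  also have "\<dots> = (\<Sum>k = 0..<n. if k = Suc i then (if 0 < lev (Suc i) then A $$ (Suc i, j) else 0) else 0)"
    using assms by (intro sum.cong) (auto simp: chain_mat_def)
  also have "\<dots> = (if Suc i < n \<and> 0 < lev (Suc i) then A $$ (Suc i, j) else 0)"
    using assms by (simp add: sum.delta)
  finally show ?thesis .
qed

text \<open>Together \<open>n\<close> and \<open>par\<close> say that all blocks have even size.
  Splitting indices by parity then separates even from odd levels, and a shift by one level
  identifies the two halves.\<close>

lemma det_commute_chain_mat_nonneg:
  fixes A :: "real mat"
  assumes A: "A \<in> carrier_mat n n" and lev: "is_level lev" and n: "even n"
    and par: "\<And>i. i < n \<Longrightarrow> even (lev i) \<longleftrightarrow> even i"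
    and comm: "A * chain_mat n lev = chain_mat n lev * A"
  shows "0 \<le> det A"
proof -
  have shift: "A $$ (Suc i, j) = (if 0 < lev j then A $$ (i, j - 1) else 0)"
    if "Suc i < n" "0 < lev (Suc i)" "j < n" for i j
    using arg_cong[OF comm, of "\<lambda>M. M $$ (i, j)"] mult_chain_mat[OF A _ _ lev, of i j]
      chain_mat_mult[OF A, of i j lev] that by simp
  \<comment> \<open>Step back along both blocks at once: the column reaches its block start first,
    while the row still has positive level, and there \<open>shift\<close> gives 0.\<close>
  have tri: "A $$ (i, j) = 0" if "i < n" "j < n" "lev j < lev i" for i j
    using that
  proof (induction "lev j" arbitrary: i j)
    case 0
    then obtain i' where "i = Suc i'" using lev by (metis is_levelD)
    then show ?case using shift[of i' j] 0 by simp
  next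
    case (Suc l)
    obtain i' where i': "i = Suc i'" "lev i = Suc (lev i')"
      using lev Suc.prems by (metis is_levelD gr_implies_not0 not_gr_zero)
    obtain j' where j': "j = Suc j'" "lev j = Suc (lev j')"
      using lev Suc.hyps(2) by (metis is_levelD zero_less_Suc)
    have "A $$ (i', j') = 0" using Suc i' j' by simp
    then show ?case using shift[of i' j] i' j' Suc.prems by simp
  qed
  define B where "B = mat n n (\<lambda>(i, j). if lev i = lev j then A $$ (i, j) else 0)"
  have detB: "det A = det B"
    unfolding B_def by (rule det_weight_triangular[OF A tri])
  have B: "B \<in> carrier_mat n n" by (simp add: B_def)
  define E where "E = mat n n (\<lambda>(i, j). if even i then B $$ (i, j) else if i = j then 1 else 0)"
  define O' where "O' = mat n n (\<lambda>(i, j). if odd i then B $$ (i, j) else if i = j then 1 else 0)"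
  have E: "E \<in> carrier_mat n n" and O': "O' \<in> carrier_mat n n" by (simp_all add: E_def O'_def)
  have split: "det B = det E * det O'"
    unfolding E_def O'_def
  proof (rule det_split_even_odd[OF B])
    fix i j assume "i < n" "j < n" "even i \<noteq> even j"
    then have "lev i \<noteq> lev j" using par by metis
    then show "B $$ (i, j) = 0" using \<open>i < n\<close> \<open>j < n\<close> by (simp add: B_def)
  qed
  \<comment> \<open>Blocks have even size, so swapping levels $2c$ and $2c+1$ is swapping indices $2i$ and $2i+1$.\<close>
  define s where "s = (\<lambda>i::nat. if i < n then if even i then Suc i else i - 1 else i)"
  have sn: "s i < n" if "i < n" for i using that n by (auto simp: s_def) presburger
  have ss: "s (s i) = i" for i using sn[of i] n by (auto simp: s_def)
  have "bij_betw s {0..<n} {0..<n}"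
    by (rule bij_betw_byWitness[of _ s]) (auto simp: ss sn)
  then have sperm: "s permutes {0..<n}"
    by (rule bij_imp_permutes) (auto simp: s_def)
  \<comment> \<open>\<open>Suc i\<close> and \<open>Suc j\<close> have odd, hence positive, level,
    so \<open>shift\<close> applies; both levels rise by one, so equality of levels is
    unaffected.\<close>
  have step: "B $$ (Suc i, Suc j) = B $$ (i, j)"
    if ij: "i < n" "j < n" "even i" "even j" for i j
  proof -
    have l: "Suc i < n" "Suc j < n" using ij n by presburger+
    then have "odd (lev (Suc i))" "odd (lev (Suc j))" using par ij by auto
    then have pos: "0 < lev (Suc i)" "0 < lev (Suc j)" by (auto intro: odd_pos)
    then have "lev (Suc i) = Suc (lev i)" "lev (Suc j) = Suc (lev j)"
      using lev unfolding is_level_def by (metis diff_Suc_1)+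
    then show ?thesis using shift[of i "Suc j"] l pos ij by (simp add: B_def)
  qed
  have "O' = mat n n (\<lambda>(i, j). E $$ (s i, s j))"
  proof (rule eq_matI)
    fix i j assume "i < dim_row (mat n n (\<lambda>(i, j). E $$ (s i, s j)))"
      "j < dim_col (mat n n (\<lambda>(i, j). E $$ (s i, s j)))"
    then have i: "i < n" and j: "j < n" by auto
    have eq: "s i = s j \<longleftrightarrow> i = j" by (metis ss)
    have ev: "even (s i) \<longleftrightarrow> odd i" "even (s j) \<longleftrightarrow> odd j"
      using i j by (auto simp: s_def)
    have "B $$ (i, j) = B $$ (s i, s j)" if "odd i"
    proof (cases "odd j")
      case True
      have "s i < n" "s j < n" using sn i j by auto
      moreover have "i = Suc (s i)" "j = Suc (s j)" using i j that True by (auto simp: s_def)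
      ultimately show ?thesis using step[of "s i" "s j"] ev that True by simp
    next
      case False
      then have "lev i \<noteq> lev j" using par i j that by metis
      moreover have "lev (s i) \<noteq> lev (s j)" using par ev sn i j that False by metis
      ultimately show ?thesis using i j sn by (simp add: B_def)
    qed
    then show "O' $$ (i, j) = mat n n (\<lambda>(i, j). E $$ (s i, s j)) $$ (i, j)"
      using i j sn ev eq by (simp add: O'_def E_def)
  qed (auto simp: O'_def)
  then have "det O' = det E" using det_permute_rows_cols[OF E sperm] by simp
  \<comment> \<open>Thus \<open>det A\<close> is the square of \<open>det E\<close>.\<close>
  then show ?thesis using detB split by simp
qed

section \<open>Sign matrices and anticommutation\<close>

lemma det_mat_diag: "det (mat_diag n c) = (\<Prod>i<n. c i :: 'a :: comm_ring_1)"
  by (subst det_upper_triangular[of _ n])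
    (auto simp: mat_diag_def prod_list_diag_prod atLeast0LessThan)

lemma mat_diag_anticommute_chain_mat:
  assumes lev: "is_level lev"
    and c: "\<And>i. Suc i < n \<Longrightarrow> 0 < lev (Suc i) \<Longrightarrow> c (Suc i) = - c i"
  shows "mat_diag n c * chain_mat n lev = - (chain_mat n lev * mat_diag n c)"
proof (rule eq_matI)
  fix i j assume "i < dim_row (- (chain_mat n lev * mat_diag n c))"
    "j < dim_col (- (chain_mat n lev * mat_diag n c))"
  then have i: "i < n" and j: "j < n" by (auto simp: chain_mat_def mat_diag_def)
  have "(mat_diag n c * chain_mat n lev) $$ (i, j) = c i * chain_mat n lev $$ (i, j)"
    using i j by (subst mat_diag_mult_left[OF chain_mat_carrier]) auto
  moreover have "(chain_mat n lev * mat_diag n c) $$ (i, j) = chain_mat n lev $$ (i, j) * c j"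
    using i j by (subst mat_diag_mult_right[OF chain_mat_carrier]) auto
  moreover have "(- (chain_mat n lev * mat_diag n c)) $$ (i, j) = - ((chain_mat n lev * mat_diag n c) $$ (i, j))"
    using i j by (simp add: chain_mat_def mat_diag_def)
  ultimately show "(mat_diag n c * chain_mat n lev) $$ (i, j) = (- (chain_mat n lev * mat_diag n c)) $$ (i, j)"
    using i j c by (auto simp: chain_mat_def)
qed (auto simp: chain_mat_def mat_diag_def)

text \<open>Each pair of consecutive indices contributes -1.\<close>

lemma prod_alternating_signs: "(\<Prod>i<2 * m. (- 1) ^ i :: 'a :: comm_ring_1) = (- 1) ^ m"
  by (induction m) auto

lemma anticommute_chain_mat_imp_4_dvd:
  fixes g :: "real mat"
  assumes g: "g \<in> carrier_mat n n" "det g = 1" and lev: "is_level lev" and n: "even n"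
    and par: "\<And>i. i < n \<Longrightarrow> even (lev i) \<longleftrightarrow> even i"
    and anti: "g * chain_mat n lev = - (chain_mat n lev * g)"
  shows "4 dvd n"
proof -
  obtain m where m: "n = 2 * m" using n by blast
  \<comment> \<open>Signs may alternate along all indices, since anticommutation restricts them only
    inside blocks.\<close>
  let ?J = "chain_mat n lev" and ?D = "mat_diag n (\<lambda>i. (- 1) ^ i :: real)"
  have J: "?J \<in> carrier_mat n n" and D: "?D \<in> carrier_mat n n" by auto
  have "?D * ?J = - (?J * ?D)"
    by (rule mat_diag_anticommute_chain_mat[OF lev]) simp
  then have "g * ?D * ?J = g * (- (?J * ?D))"
    using assoc_mult_mat[OF g(1) D J] by simp
  also have "\<dots> = - (g * (?J * ?D))"
    using g carrier_matD[OF J] carrier_matD[OF D] by (intro uminus_mult_right_mat) auto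
  also have "\<dots> = - (g * ?J * ?D)"
    using assoc_mult_mat[OF g(1) J D] by simp
  also have "\<dots> = - (- (?J * g * ?D))"
    unfolding anti using g carrier_matD[OF J] carrier_matD[OF D]
    by (subst uminus_mult_left_mat) auto
  also have "\<dots> = ?J * (g * ?D)"
    using assoc_mult_mat[OF J g(1) D] by simp
  finally have "0 \<le> det (g * ?D)"
    using g D by (intro det_commute_chain_mat_nonneg[OF _ lev n par]) auto
  then have "0 \<le> (- 1 :: real) ^ m"
    using det_mult[OF g(1) D] g by (simp add: det_mat_diag m prod_alternating_signs)
  then have "even m" by (cases "even m") auto
  then show ?thesis using m by auto
qed

section \<open>Levels and signs read off from a list of block sizes\<close>

text \<open>Indices past the last block get the default level 0, so that \<open>is_level\<close>
  holds on all natural numbers.\<close>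

primrec block_level :: "nat list \<Rightarrow> nat \<Rightarrow> nat" where
  "block_level [] i = 0"
| "block_level (k # ks) i = (if i < k then i else block_level ks (i - k))"

lemma is_level_block_level: "is_level (block_level ks)"
  unfolding is_level_def
proof
  show "0 < block_level ks j \<longrightarrow> 0 < j \<and> block_level ks j = Suc (block_level ks (j - 1))" for j
  proof (induction ks arbitrary: j)
    case (Cons k ks)
    \<comment> \<open>A positive level at \<open>j - k\<close> in the tail forces
      \<open>k < j\<close>, so \<open>j - 1\<close> stays outside the first block.\<close>
    show ?case using Cons.IH[of "j - k"] by (auto simp: diff_right_commute)
  qed simp
qed

lemma block_level_0: "block_level ks 0 = 0"
  using is_level_block_level[of ks] unfolding is_level_def by blast

text \<open>Passing a block subtracts an even number. The bound on \<open>i\<close> keeps away from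
  the default level 0.\<close>

lemma even_block_level:
  "\<forall>k \<in> set ks. even k \<Longrightarrow> i < sum_list ks \<Longrightarrow> even (block_level ks i) \<longleftrightarrow> even i"
  by (induction ks arbitrary: i) auto

lemma jordan_matrix_nilpotent:
  "jordan_matrix (map (\<lambda>k. (k, 0 :: real)) ks) = chain_mat (sum_list ks) (block_level ks)"
proof (induction ks)
  case Nil
  show ?case by (rule eq_matI) (auto simp: jordan_matrix_def chain_mat_def)
next
  case (Cons k ks)
  let ?N = "chain_mat (sum_list ks) (block_level ks)"
  have "jordan_matrix (map (\<lambda>k. (k, 0 :: real)) (k # ks)) =
      four_block_mat (jordan_block k 0) (0\<^sub>m k (sum_list ks)) (0\<^sub>m (sum_list ks) k) ?N"
    using Cons.IH by (simp add: jordan_matrix_def Let_def chain_mat_def)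
  also have "\<dots> = chain_mat (sum_list (k # ks)) (block_level (k # ks))"
    \<comment> \<open>The superdiagonal entry across the border of the first block is 0, because the
      next block starts with level 0.\<close>
    by (rule eq_matI)
      (auto simp: chain_mat_def jordan_block_def Suc_diff_le block_level_0)
  finally show ?case .
qed

lemma block_level_append:
  "block_level (as @ ks) (sum_list as + i) = block_level ks i"
  by (induction as) (auto simp: add.assoc)

text \<open>Supplies the diagonal of an involution of determinant 1 that anticommutes with the
  Jordan matrix.\<close>

lemma ex_signs_prod_1:
  assumes n: "n = sum_list ks" and ks: "(\<exists>k \<in> set ks. odd k) \<or> 4 dvd n"
  obtains c :: "nat \<Rightarrow> real" where "\<And>i. c i * c i = 1"
    "\<And>i. 0 < block_level ks (Suc i) \<Longrightarrow> c (Suc i) = - c i" "(\<Prod>i<n. c i) = 1"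
proof (cases "\<exists>k \<in> set ks. odd k")
  case False
  then obtain m where "n = 2 * (2 * m)" using ks by (auto elim!: dvdE)
  then have "(\<Prod>i<n. (- 1) ^ i :: real) = 1" by (simp only: prod_alternating_signs) simp
  then show thesis
    by (intro that[of "\<lambda>i. (- 1) ^ i"]) (auto simp: power_mult_distrib[symmetric])
next
  case True
  then obtain k as bs where ks_eq: "ks = as @ k # bs" and k: "odd k"
    by (metis split_list)
  define c :: "nat \<Rightarrow> real" where "c i = (- 1) ^ block_level ks i" for i
  have c2: "c i * c i = 1" for i
    by (simp add: c_def power_mult_distrib[symmetric])
  have alt: "c (Suc i) = - c i" if "0 < block_level ks (Suc i)" for i
    using that is_level_block_level[of ks] by (auto simp: c_def elim: is_levelD)
  have "(\<Prod>i<n. c i) * (\<Prod>i<n. c i) = 1"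
    by (simp add: prod.distrib[symmetric] c2)
  then consider "(\<Prod>i<n. c i) = 1" | "(\<Prod>i<n. c i) = - 1"
    by (auto simp: square_eq_1_iff)
  then show thesis
  proof cases
    case 1
    then show thesis using that[of c] c2 alt by blast
  next
    case 2
    \<comment> \<open>\<open>?I\<close> is the index range of the chosen odd block; \<open>e\<close>
      flips its signs.\<close>
    let ?I = "{sum_list as..<sum_list as + k}"
    define e :: "nat \<Rightarrow> real" where "e i = (if i \<in> ?I then - 1 else 1)" for i
    \<comment> \<open>\<open>e\<close> changes value only at the two ends of \<open>?I\<close>. Both
      have level 0, where no alternation is required.\<close>
    have "block_level ks (sum_list as) = 0"
      using block_level_append[of as "k # bs" 0] block_level_0[of "k # bs"] by (simp add: ks_eq)
    moreover have "block_level ks (sum_list as + k) = 0"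
      using block_level_append[of as "k # bs" k] block_level_0[of bs] by (simp add: ks_eq)
    ultimately have e_const: "e (Suc i) = e i" if "0 < block_level ks (Suc i)" for i
      using that unfolding e_def
      by (cases "Suc i = sum_list as \<or> Suc i = sum_list as + k") auto
    have "(\<Prod>i<n. e i) = (- 1) ^ card ({..<n} \<inter> ?I)"
      by (simp add: e_def prod.If_cases Int_def)
    also have "{..<n} \<inter> ?I = ?I" by (auto simp: n ks_eq)
    finally have "(\<Prod>i<n. e i) = - 1" using k by simp
    then have "(\<Prod>i<n. e i * c i) = 1" using 2 by (simp add: prod.distrib)
    moreover have "e i * c i * (e i * c i) = 1" for i
      using c2[of i] by (simp add: e_def)
    ultimately show thesis
      using that[of "\<lambda>i. e i * c i"] alt e_const by simp
  qed
qed

section \<open>The adjoint action as an anticommutation relation\<close>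

lemma group_SL: "group (SL_group n)"
proof (rule groupI)
  fix x assume "x \<in> carrier (SL_group n)"
  then have x: "x \<in> carrier_mat n n" "det x = 1" by (auto simp: SL_group_def)
  obtain y where y: "y \<in> carrier_mat n n" "y * x = 1\<^sub>m n"
    using det_non_zero_imp_unit[OF x(1)] x(2) by (auto simp: Units_def ring_mat_def)
  then have "det y = 1" using det_mult[OF y(1) x(1)] x(2) by simp
  then show "\<exists>y \<in> carrier (SL_group n). y \<otimes>\<^bsub>SL_group n\<^esub> x = \<one>\<^bsub>SL_group n\<^esub>"
    using y by (auto simp: SL_group_def)
qed (auto simp: SL_group_def det_mult)

text \<open>Clearing the group inverse leaves an identity of matrix products that can be moved to
  the Jordan form.\<close>

lemma uminus_eq_Ad_iff:
  assumes X: "X \<in> carrier_mat n n" and g: "g \<in> carrier (SL_group n)"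
  shows "- X = Ad (SL_group n) g X \<longleftrightarrow> g * X = - (X * g)"
proof -
  define h where "h = inv\<^bsub>SL_group n\<^esub> g"
  have gc: "g \<in> carrier_mat n n" using g by (simp add: SL_group_def)
  have "h \<in> carrier (SL_group n)"
    unfolding h_def using group.inv_closed[OF group_SL g] .
  then have h: "h \<in> carrier_mat n n" by (simp add: SL_group_def)
  have hg: "h * g = 1\<^sub>m n" "g * h = 1\<^sub>m n"
    using group.l_inv[OF group_SL g] group.r_inv[OF group_SL g]
    by (simp_all add: h_def SL_group_def)
  have "- X = g * X * h" if "g * X = - (X * g)"
  proof -
    have "g * X * h = - (X * g * h)"
      unfolding that by (rule uminus_mult_left_mat) (use X gc h in auto)
    then show ?thesis using assoc_mult_mat[OF X gc h] hg X by simp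
  qed
  moreover have "g * X = - (X * g)" if "- X = g * X * h"
  proof -
    have "- (X * g) = - X * g" by (rule uminus_mult_left_mat[symmetric]) (use X gc in auto)
    also have "\<dots> = g * X * (h * g)"
      unfolding that using assoc_mult_mat[of "g * X" n n h n g n] X gc h by simp
    finally show ?thesis using hg X gc by simp
  qed
  ultimately show ?thesis unfolding Ad_def h_def by blast
qed

text \<open>The similarity gives \<open>X * P = P * J\<close> and \<open>Q * X = J * Q\<close>, so
  \<open>X\<close> can be exchanged for \<open>J\<close> on either side of \<open>g\<close>.\<close>

lemma anticommute_similar:
  fixes X J P Q g :: "'a :: comm_ring_1 mat"
  assumes wit: "similar_mat_wit X J P Q" and X: "X \<in> carrier_mat n n"
    and g: "g \<in> carrier_mat n n" and anti: "g * X = - (X * g)"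
  shows "Q * g * P * J = - (J * (Q * g * P))"
proof -
  note w = similar_mat_witD2[OF X wit]
  have c: "P \<in> carrier_mat n n" "Q \<in> carrier_mat n n" "J \<in> carrier_mat n n" using w by auto
  note assoc = assoc_mult_mat[of _ n n _ n _ n]
  have XP: "X * P = P * J"
    using w(2) c by (simp add: w(3) assoc)
  have QX: "Q * X = J * Q"
    using w(2) c assoc[of Q P "J * Q"] by (simp add: w(3) assoc)
  have "Q * g * P * J = Q * (g * X) * P"
    using c g X by (simp add: assoc XP mult_carrier_mat[of _ n n _ n])
  also have "\<dots> = - (Q * (X * g) * P)"
    unfolding anti using c g X
    by (subst uminus_mult_right_mat) (auto intro!: uminus_mult_left_mat)
  also have "Q * (X * g) * P = J * (Q * g * P)"
    using c g X QX assoc[of Q X g] assoc[of J Q g] assoc[of J "Q * g" P] by simp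
  finally show ?thesis .
qed

section \<open>The partition condition modulo 4\<close>

text \<open>Even parts are 0 or 2 mod 4, so the sum is congruent mod 4 to twice the number of parts
  of the second kind.\<close>

lemma even_size_filter_2mod4_iff:
  fixes d :: "nat multiset"
  assumes "\<forall>k \<in># d. even k"
  shows "even (size {#k \<in># d. k mod 4 = 2#}) \<longleftrightarrow> 4 dvd sum_mset d"
  using assms
proof (induction d)
  case (add k d)
  then have IH: "even (size {#k \<in># d. k mod 4 = 2#}) \<longleftrightarrow> 4 dvd sum_mset d" by simp
  have "even (sum_mset d)" using add.prems by (induction d) auto
  moreover have "even k" using add.prems by simp
  ultimately have "4 dvd k + sum_mset d \<longleftrightarrow> (4 dvd sum_mset d \<longleftrightarrow> k mod 4 \<noteq> 2)"
    by presburger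
  then show ?case using IH by auto
qed simp

lemma mem_tilde_even_partitions_iff:
  assumes d: "d \<in> partitions n"
  shows "d \<in> tilde_even_partitions n \<longleftrightarrow> (\<forall>k \<in># d. even k) \<and> \<not> 4 dvd n"
proof -
  have n: "sum_mset d = n" using d by (simp add: partitions_def)
  have even: "d \<in> even_partitions n \<longleftrightarrow> (\<forall>k \<in># d. even k)"
    using d by (auto simp: even_partitions_def even_parts_def)
  \<comment> \<open>Here every summand is an even multiplicity.\<close>
  have very: "even (\<Sum>k \<in> even_parts_2mod4 d. count d k)" if "d \<in> very_even_partitions n"
    using that by (intro dvd_sum)
      (auto simp: very_even_partitions_def even_parts_2mod4_def even_parts_def)
  have "even_parts_2mod4 d = set_mset {#k \<in># d. k mod 4 = 2#}"
    by (auto simp: even_parts_2mod4_def even_parts_def) presburger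
  then have "(\<Sum>k \<in> even_parts_2mod4 d. count d k) = size {#k \<in># d. k mod 4 = 2#}"
    by (simp add: size_multiset_overloaded_eq)
  then show ?thesis
    using even very even_size_filter_2mod4_iff[of d] n
    by (auto simp: tilde_even_partitions_def)
qed

section \<open>Realness in terms of the partition\<close>

theorem theorem5p1:
  fixes n :: nat and X :: "real mat" and d :: "nat multiset"
  assumes "X \<in> sl_algebra n"
    and "nilpotent_mat n X"
    and "d \<in> partitions n"
    and "corresponds_to_partition X d"
  shows "(Ad_real (SL_group n) X \<longleftrightarrow> strongly_Ad_real (SL_group n) X)
    \<and> (strongly_Ad_real (SL_group n) X \<longleftrightarrow> d \<notin> tilde_even_partitions n)"
proof -
  have X: "X \<in> carrier_mat n n" using assms(1) by (simp add: sl_algebra_def)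
  obtain ks where ks: "mset ks = d" and jnf: "jordan_nf X (map (\<lambda>k. (k, 0)) ks)"
    using assms(4) unfolding corresponds_to_partition_def by blast
  have n: "n = sum_list ks"
    using assms(3) ks by (auto simp: partitions_def sum_mset_sum_list)
  let ?J = "chain_mat n (block_level ks)"
  obtain P Q where wit: "similar_mat_wit X ?J P Q"
    using jnf unfolding jordan_nf_def similar_mat_def jordan_matrix_nilpotent n by blast
  note w = similar_mat_witD2[OF X wit]
  \<comment> \<open>\<open>P\<close> need not have determinant 1, but this suffices for conjugation
    by \<open>P\<close> to preserve determinants.\<close>
  have detPQ: "det P * det Q = 1" using det_mult[OF w(6,7)] w(1) by simp
  \<comment> \<open>The equivalences are closed as a cycle: (3) gives (2), (1) gives (3), and (2)
    gives (1).\<close>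
  have "strongly_Ad_real (SL_group n) X" if "d \<notin> tilde_even_partitions n"
  proof -
    have "(\<exists>k \<in> set ks. odd k) \<or> 4 dvd n"
      using that ks mem_tilde_even_partitions_iff[OF assms(3)] by auto
    from ex_signs_prod_1[OF n this] obtain c :: "nat \<Rightarrow> real" where
      c: "\<And>i. c i * c i = 1" "\<And>i. 0 < block_level ks (Suc i) \<Longrightarrow> c (Suc i) = - c i"
        "(\<Prod>i<n. c i) = 1" by metis
    let ?D = "mat_diag n c"
    let ?t = "P * ?D * Q"
    have D: "?D \<in> carrier_mat n n" by simp
    have "?D * ?J = - (?J * ?D)"
      by (rule mat_diag_anticommute_chain_mat[OF is_level_block_level]) (rule c(2))
    then have "?t * X = - (X * ?t)"
      \<comment> \<open>The reversed similarity exchanges \<open>P\<close> and \<open>Q\<close>,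
        carrying the sign matrix from the Jordan form back to \<open>X\<close>.\<close>
      by (rule anticommute_similar[OF similar_mat_wit_sym[OF wit] w(5) D])
    moreover have "det ?t = 1"
      using w D detPQ c(3) by (simp add: det_mult[of _ n] det_mat_diag)
    moreover have "?t * ?t = P * (?D * (Q * P) * ?D) * Q"
      using w(6,7) D by (simp add: assoc_mult_mat[of _ n n _ n _ n] mult_carrier_mat[of _ n n _ n])
    then have tt: "?t * ?t = 1\<^sub>m n"
      unfolding w(2) using w(1,6) D c(1) by simp
    moreover have "?t \<in> carrier_mat n n" using w D by auto
    ultimately show ?thesis
      unfolding strongly_Ad_real_def using uminus_eq_Ad_iff[OF X, of ?t] tt
      by (intro bexI[of _ ?t]) (auto simp: SL_group_def)
  qed
  moreover have "d \<notin> tilde_even_partitions n" if real: "Ad_real (SL_group n) X"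
  proof
    assume "d \<in> tilde_even_partitions n"
    then have ev: "\<forall>k \<in> set ks. even k" and n4: "\<not> 4 dvd n"
      using ks mem_tilde_even_partitions_iff[OF assms(3)] by auto
    obtain g where g: "g \<in> carrier (SL_group n)" "- X = Ad (SL_group n) g X"
      using real unfolding Ad_real_def by blast
    then have gc: "g \<in> carrier_mat n n" "det g = 1" by (auto simp: SL_group_def)
    \<comment> \<open>Move \<open>g\<close> to the Jordan form, where the level argument
      applies.\<close>
    have anti: "Q * g * P * ?J = - (?J * (Q * g * P))"
      using anticommute_similar[OF wit X gc(1)] uminus_eq_Ad_iff[OF X g(1)] g(2) by blast
    have "det (Q * g * P) = 1"
      using w gc detPQ by (simp add: det_mult[of _ n] mult.commute)
    moreover have "even n"
      unfolding n using ev by (induction ks) auto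
    moreover have "Q * g * P \<in> carrier_mat n n" using w gc by auto
    ultimately have "4 dvd n"
      using even_block_level[OF ev] n anti
      by (intro anticommute_chain_mat_imp_4_dvd[OF _ _ is_level_block_level]) auto
    then show False using n4 by blast
  qed
  moreover have "Ad_real (SL_group n) X" if "strongly_Ad_real (SL_group n) X"
    using that unfolding strongly_Ad_real_def Ad_real_def by blast
  ultimately show ?thesis by blast
qed

end
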